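(* Consider feasibility integer linear programs of the form $\mathcal{A}x=b$, $x\in\mathbb{Z}_{\geq0}^N$, with $\mathcal{A}\in\mathbb{Z}^{M\times N}$ and $b\in\mathbb{Z}^M$, and let $U$ be an upper bound on the $\ell_\infty$-norm of the smallest feasible solution. Then every such feasibility ILP has a static equivalent instance (a feasibility ILP of the same form) of encoding size $O(MN^2\log(NU))$.
   Context: A static equivalent instance of an instance $I$ of a problem is an instance $I'$ of the same problem that has exactly the same set of solutions as $I$. The solutions of the feasibility ILP $\mathcal{A}x=b$, $x\in\mathbb{Z}_{\geq 0}^N$ are the vectors $x\in\mathbb{Z}^N_{\geq 0}$ with $\mathcal{A}x=b$. Size means binary encoding length.
   Formalization: Exact static equivalence is false here; proved instead: same solutions of ℓ∞-norm at most U and no new solutions (solutions larger than U may be lost). log(NU) is read as max(1, log2(NU)), with M, N ≥ 1. *)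

theory Defs
  imports Complex_Main "Jordan_Normal_Form.Matrix"
begin

text \<open>The pair \<open>(A, b)\<close> stands for the program \<open>A x = b\<close>, \<open>x \<ge> 0\<close>, \<open>x\<close> integral.\<close>

type_synonym ilp = "int mat \<times> int vec"

definition ilps :: "nat \<Rightarrow> nat \<Rightarrow> ilp set" where
  "ilps M N = carrier_mat M N \<times> carrier_vec M"

fun solutions :: "ilp \<Rightarrow> int vec set" where
  "solutions (A, b) =
    {x \<in> carrier_vec (dim_col A). (\<forall>j < dim_col A. 0 \<le> x $ j) \<and> A *\<^sub>v x = b}"

definition linf_norm :: "int vec \<Rightarrow> int" where
  "linf_norm x = Max (insert 0 ((\<lambda>j. \<bar>x $ j\<bar>) ` {..<dim_vec x}))"

definition smallest_solution :: "ilp \<Rightarrow> int vec \<Rightarrow> bool" where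
  "smallest_solution P x \<longleftrightarrow>
    x \<in> solutions P \<and> (\<forall>y \<in> solutions P. linf_norm x \<le> linf_norm y)"

text \<open>Binary encoding length: sign bit plus \<open>\<lceil>log\<^sub>2 (\<bar>z\<bar> + 1)\<rceil>\<close> magnitude bits for an integer,
  summed over all entries (zeros included) for a program.\<close>

definition int_size :: "int \<Rightarrow> nat" where
  "int_size z = 1 + nat \<lceil>log 2 (real_of_int \<bar>z\<bar> + 1)\<rceil>"

fun encoding_size :: "ilp \<Rightarrow> nat" where
  "encoding_size (A, b) =
    (\<Sum>i<dim_row A. \<Sum>j<dim_col A. int_size (A $$ (i, j))) + (\<Sum>i<dim_vec b. int_size (b $ i))"

definition static_equivalent :: "ilp \<Rightarrow> ilp \<Rightarrow> bool" where
  "static_equivalent P Q \<longleftrightarrow> solutions P = solutions Q"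

text \<open>A bound on the smallest solution says nothing about the size of the others, so no bound in
  \<open>M\<close>, \<open>N\<close>, \<open>U\<close> can hold for \<open>static_equivalent\<close> itself: the solutions of
  \<open>n x\<^sub>1 - (n + 1) x\<^sub>2 = 0\<close> are the multiples of \<open>(n + 1, n)\<close>, the smallest one is \<open>0\<close>, and every
  program with these solutions has a nonzero coefficient divisible by \<open>n\<close>.
  The relation below asks for the same solutions in the box given by \<open>U\<close> and for no new solution
  outside it; it is static equivalence whenever \<open>U\<close> bounds all solutions.\<close>

definition static_equivalent_upto :: "nat \<Rightarrow> ilp \<Rightarrow> ilp \<Rightarrow> bool" where
  "static_equivalent_upto U P Q \<longleftrightarrow>
    {x \<in> solutions P. linf_norm x \<le> int U} = {x \<in> solutions Q. linf_norm x \<le> int U} \<and>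
    solutions Q \<subseteq> solutions P"

lemma static_equivalent_upto_bounded:
  assumes "static_equivalent_upto U P Q" and "\<forall>x \<in> solutions P. linf_norm x \<le> int U"
  shows "static_equivalent P Q"
  using assms unfolding static_equivalent_upto_def static_equivalent_def by blast

lemma linf_norm_nonneg: "0 \<le> linf_norm x"
  unfolding linf_norm_def by (rule Max_ge) auto

lemma ex_smallest_solution:
  assumes "solutions P \<noteq> {}"
  shows "\<exists>x. smallest_solution P x"
proof -
  obtain x where "x \<in> solutions P" "\<forall>y. y \<in> solutions P \<longrightarrow> nat (linf_norm x) \<le> nat (linf_norm y)"
    using assms ex_has_least_nat[of "\<lambda>x. x \<in> solutions P" _ "\<lambda>x. nat (linf_norm x)"] by blast
  then show ?thesis
    unfolding smallest_solution_def using linf_norm_nonneg by (metis nat_le_eq_zle)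
qed

lemma static_equivalent_upto_feasible_iff:
  assumes "static_equivalent_upto U P Q" and "\<forall>x. smallest_solution P x \<longrightarrow> linf_norm x \<le> int U"
  shows "solutions P = {} \<longleftrightarrow> solutions Q = {}"
  using assms ex_smallest_solution[of P]
  unfolding static_equivalent_upto_def smallest_solution_def by blast

end

theory Submission
  imports Defs "HOL-Library.FuncSet"
begin

text \<open>Let \<open>S\<close> be the set of vectors \<open>(x, -1)\<close> with \<open>x\<close> a solution in the box given by \<open>U\<close>. The integer
  vectors orthogonal to \<open>S\<close> are the equations \<open>a x = \<beta>\<close> valid on these solutions. They form a lattice
  that contains all rows of the given program, so linearly independent vectors spanning it over the
  rationals form a suitable program. Minkowski's second theorem, obtained from the pigeonhole
  principle, yields such vectors \<open>v i\<close> with \<open>\<Prod>\<^sub>i |v i| \<le> (N U)\<^bsup>O(N)\<^esup>\<close>. Since the size is at most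
  about \<open>N\<close> times \<open>\<Sum>\<^sub>i log |v i|\<close>, it is \<open>O(N\<^sup>2 log (N U))\<close>. For \<open>U = 0\<close> the only candidate in the
  box is \<open>0\<close>, which is treated directly.\<close>

section \<open>Inner products, orthonormal systems and projections\<close>

definition ip :: "nat \<Rightarrow> (nat \<Rightarrow> real) \<Rightarrow> (nat \<Rightarrow> real) \<Rightarrow> real" where
  "ip n u v = (\<Sum>l<n. u l * v l)"

abbreviation rv :: "(nat \<Rightarrow> int) \<Rightarrow> nat \<Rightarrow> real" where
  "rv a \<equiv> (\<lambda>l. real_of_int (a l))"

definition orthonormal :: "nat \<Rightarrow> nat \<Rightarrow> (nat \<Rightarrow> nat \<Rightarrow> real) \<Rightarrow> bool" where
  "orthonormal n d e \<longleftrightarrow> (\<forall>i<d. \<forall>j<d. ip n (e i) (e j) = (if i = j then 1 else 0))"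

lemma ip_commute: "ip n u v = ip n v u"
  by (simp add: ip_def mult.commute)

lemma ip_self_nonneg: "0 \<le> ip n u u"
  by (simp add: ip_def sum_nonneg)

lemma ip_self_eq_0: "ip n u u = 0 \<longleftrightarrow> (\<forall>l<n. u l = 0)"
  unfolding ip_def by (subst sum_nonneg_eq_0_iff) auto

lemma ip_scale: "ip n u (\<lambda>l. c * v l) = c * ip n u v"
  by (simp add: ip_def sum_distrib_left mult_ac)

lemma ip_diff: "ip n u (\<lambda>l. v l - w l) = ip n u v - ip n u w"
  by (simp add: ip_def right_diff_distrib sum_subtractf)

lemma ip_sum: "ip n u (\<lambda>l. \<Sum>i<d. c i * e i l) = (\<Sum>i<d. c i * ip n u (e i))"
proof -
  have "ip n u (\<lambda>l. \<Sum>i<d. c i * e i l) = (\<Sum>l<n. \<Sum>i<d. c i * (u l * e i l))"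
    by (simp add: ip_def sum_distrib_left mult_ac)
  also have "\<dots> = (\<Sum>i<d. \<Sum>l<n. c i * (u l * e i l))"
    by (rule sum.swap)
  finally show ?thesis by (simp add: ip_def sum_distrib_left)
qed

lemma ip_rv: "ip n (rv a) (rv b) = real_of_int (\<Sum>l<n. a l * b l)"
  by (simp add: ip_def)

lemma entry_sq_le_ip: "l < n \<Longrightarrow> (u l)\<^sup>2 \<le> ip n u u"
  unfolding ip_def power2_eq_square by (rule member_le_sum[of l "{..<n}" "\<lambda>l. u l * u l"]) auto

text \<open>The Gram-Schmidt step: for orthonormal \<open>e\<close> this is \<open>w\<close> minus
  its orthogonal projection onto the span of \<open>e 0, ..., e (d - 1)\<close>.\<close>

definition residual :: "nat \<Rightarrow> (nat \<Rightarrow> nat \<Rightarrow> real) \<Rightarrow> nat \<Rightarrow> (nat \<Rightarrow> real) \<Rightarrow> nat \<Rightarrow> real" where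
  "residual n e d w = (\<lambda>l. w l - (\<Sum>i<d. ip n (e i) w * e i l))"

lemma ip_residual: "ip n z (residual n e d w) = ip n z w - (\<Sum>i<d. ip n (e i) w * ip n z (e i))"
  unfolding residual_def by (simp add: ip_diff ip_sum)

lemma residual_orthogonal:
  assumes "orthonormal n d e" "j < d"
  shows "ip n (e j) (residual n e d w) = 0"
proof -
  have "(\<Sum>i<d. ip n (e i) w * ip n (e j) (e i)) = (\<Sum>i<d. if i = j then ip n (e i) w else 0)"
    using assms by (intro sum.cong) (auto simp: orthonormal_def)
  also have "\<dots> = ip n (e j) w" using assms(2) by simp
  finally show ?thesis by (simp add: ip_residual)
qed

text \<open>Pythagoras: the residual is orthogonal to every \<open>e i\<close>, so its product with
  itself equals its product with \<open>w\<close>.\<close>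

lemma ip_residual_self:
  assumes "orthonormal n d e"
  shows "ip n (residual n e d w) (residual n e d w) = ip n w w - (\<Sum>i<d. (ip n (e i) w)\<^sup>2)"
proof -
  have "ip n (residual n e d w) (residual n e d w) = ip n (residual n e d w) w"
    by (subst ip_residual) (simp add: residual_orthogonal[OF assms] ip_commute[of _ "residual n e d w"])
  also have "\<dots> = ip n w (residual n e d w)" by (rule ip_commute)
  also have "\<dots> = ip n w w - (\<Sum>i<d. (ip n (e i) w)\<^sup>2)"
    by (simp add: ip_residual power2_eq_square ip_commute[of n w "e _"])
  finally show ?thesis .
qed

lemma bessel:
  assumes "orthonormal n d e"
  shows "(\<Sum>i<d. (ip n (e i) w)\<^sup>2) \<le> ip n w w"
  using ip_self_nonneg[of n "residual n e d w"] ip_residual_self[OF assms] by simp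

text \<open>Sum Bessel's inequality over the standard unit vectors.\<close>

lemma orthonormal_le_dim:
  assumes "orthonormal n d e"
  shows "d \<le> n"
proof -
  have unit: "ip n u (\<lambda>l. if l = k then 1 else 0) = u k" if "k < n" for k u
    unfolding ip_def using that by (simp add: if_distrib cong: if_cong)
  have "real d = (\<Sum>i<d. ip n (e i) (e i))"
    using assms by (simp add: orthonormal_def)
  also have "\<dots> = (\<Sum>k<n. \<Sum>i<d. (e i k)\<^sup>2)"
    unfolding ip_def power2_eq_square by (rule sum.swap)
  also have "\<dots> \<le> (\<Sum>k<n. 1)"
  proof (rule sum_mono)
    fix k assume "k \<in> {..<n}"
    then show "(\<Sum>i<d. (e i k)\<^sup>2) \<le> 1"
      using bessel[OF assms, of "\<lambda>l. if l = k then 1 else 0"] by (simp add: unit)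
  qed
  finally show ?thesis by simp
qed

text \<open>By Parseval, \<open>\<not> outside n e k a\<close> says that \<open>a\<close> lies in the span of \<open>e 0, \<dots>, e (k - 1)\<close>.\<close>

definition outside :: "nat \<Rightarrow> (nat \<Rightarrow> nat \<Rightarrow> real) \<Rightarrow> nat \<Rightarrow> (nat \<Rightarrow> int) \<Rightarrow> bool" where
  "outside n e k a \<longleftrightarrow> (\<Sum>i<k. (ip n (e i) (rv a))\<^sup>2) < ip n (rv a) (rv a)"

lemma outside_antimono:
  assumes "outside n e k a" "j \<le> k"
  shows "outside n e j a"
proof -
  have "(\<Sum>i<j. (ip n (e i) (rv a))\<^sup>2) \<le> (\<Sum>i<k. (ip n (e i) (rv a))\<^sup>2)"
    using assms(2) by (intro sum_mono2) auto
  then show ?thesis using assms(1) unfolding outside_def by linarith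
qed

text \<open>Not being outside forces equality in Bessel's inequality. The residual then vanishes on
  all coordinates below \<open>n\<close>, so \<open>a\<close> is a combination of the
  \<open>e i\<close> there.\<close>

lemma orthogonal_if_not_outside:
  assumes "orthonormal n d e" "\<not> outside n e d a" "\<And>i. i < d \<Longrightarrow> ip n (e i) z = 0"
  shows "ip n (rv a) z = 0"
proof -
  have "ip n (residual n e d (rv a)) (residual n e d (rv a)) = 0"
    using ip_residual_self[OF assms(1), of "rv a"] assms(2)
      ip_self_nonneg[of n "residual n e d (rv a)"] unfolding outside_def by linarith
  then have "ip n z (residual n e d (rv a)) = 0"
    unfolding ip_self_eq_0 by (simp add: ip_def)
  then show ?thesis
    using assms(3) by (simp add: ip_residual ip_commute[of n z])
qed

section \<open>Successive minima of a set of integer vectors\<close>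

text \<open>The vectors \<open>v i\<close> attain the successive minima of \<open>T\<close> in the Euclidean norm, and
  \<open>e\<close> is their Gram-Schmidt orthonormalisation.\<close>

definition minima_system ::
    "nat \<Rightarrow> (nat \<Rightarrow> int) set \<Rightarrow> nat \<Rightarrow> (nat \<Rightarrow> nat \<Rightarrow> int) \<Rightarrow> (nat \<Rightarrow> nat \<Rightarrow> real) \<Rightarrow> bool" where
  "minima_system n T d v e \<longleftrightarrow> orthonormal n d e \<and>
    (\<forall>i<d. v i \<in> T \<and> outside n e i (v i) \<and>
      (\<forall>a\<in>T. outside n e i a \<longrightarrow> ip n (rv (v i)) (rv (v i)) \<le> ip n (rv a) (rv a)) \<and>
      (\<forall>z. (\<forall>j\<le>i. ip n (rv (v j)) z = 0) \<longrightarrow> ip n (e i) z = 0))"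

text \<open>Greedy choice: squared lengths of integer vectors are natural numbers, so some element
  of \<open>T\<close> outside the current span is shortest. Its normalised residual is the next
  orthonormal vector.\<close>

lemma minima_system_extend:
  assumes ms: "minima_system n T d v e" and a: "a \<in> T" "outside n e d a"
  shows "\<exists>v' e'. minima_system n T (Suc d) v' e'"
proof -
  have on: "orthonormal n d e" using ms by (simp add: minima_system_def)
  obtain b where b: "b \<in> T" "outside n e d b"
    and least: "\<And>c. c \<in> T \<Longrightarrow> outside n e d c \<Longrightarrow>
      nat (\<Sum>l<n. b l * b l) \<le> nat (\<Sum>l<n. c l * c l)"
    using ex_has_least_nat[of "\<lambda>c. c \<in> T \<and> outside n e d c" a "\<lambda>c. nat (\<Sum>l<n. c l * c l)"] a
    by blast
  have least': "ip n (rv b) (rv b) \<le> ip n (rv c) (rv c)" if "c \<in> T" "outside n e d c" for c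
    using least[OF that] unfolding ip_rv of_int_le_iff by (simp add: nat_le_eq_zle sum_nonneg)
  define s where "s = residual n e d (rv b)"
  define q where "q = sqrt (ip n s s)"
  have "ip n s s > 0"
    using b(2) ip_residual_self[OF on, of "rv b"] unfolding outside_def s_def by simp
  then have q: "q > 0" "q * q = ip n s s" unfolding q_def by auto
  define g where "g = (\<lambda>l. 1 / q * s l)"
  define e' where "e' = e(d := g)"
  define v' where "v' = v(d := b)"
  have e'_lt: "e' i = e i" and v'_lt: "v' i = v i" if "i < d" for i
    using that by (auto simp: e'_def v'_def)
  have out: "outside n e' i c = outside n e i c" if "i \<le> d" for i c
    using that unfolding outside_def by (simp add: e'_lt)
  have gg: "ip n g g = 1"
  proof -
    have "ip n g g = 1 / q * (1 / q * ip n s s)"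
      unfolding g_def by (subst ip_scale, subst ip_commute, subst ip_scale) (rule refl)
    then show ?thesis using q(1) by (simp add: q(2)[symmetric])
  qed
  have eg: "ip n (e i) g = 0" if "i < d" for i
    unfolding g_def ip_scale using residual_orthogonal[OF on that, of "rv b"] by (simp add: s_def)
  have on': "orthonormal n (Suc d) e'"
    unfolding orthonormal_def
  proof (intro allI impI)
    fix i j assume "i < Suc d" "j < Suc d"
    then show "ip n (e' i) (e' j) = (if i = j then 1 else 0)"
      using gg eg[of i] eg[of j] on ip_commute[of n g "e j"]
      by (cases "i = d"; cases "j = d") (auto simp: e'_def orthonormal_def)
  qed
  \<comment> \<open>The last clause of \<open>minima_system\<close> expresses by duality that
    \<open>e i\<close> lies in the span of \<open>v 0, ..., v i\<close>. For the new index,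
    \<open>g\<close> is a combination of \<open>b\<close> and the earlier
    \<open>e j\<close>.\<close>
  have span: "ip n (e' i) z = 0" if "i < Suc d" "\<forall>j\<le>i. ip n (rv (v' j)) z = 0" for i z
  proof (cases "i = d")
    case False
    then have "i < d" using that(1) by simp
    moreover have "\<forall>j\<le>i. ip n (rv (v j)) z = 0"
      using that(2) \<open>i < d\<close> v'_lt by (metis order.strict_trans1)
    ultimately show ?thesis using ms by (simp add: minima_system_def e'_lt)
  next
    case True
    have "ip n (e j) z = 0" if j: "j < d" for j
    proof -
      have "\<forall>k\<le>j. ip n (rv (v k)) z = 0"
        using \<open>\<forall>j\<le>i. ip n (rv (v' j)) z = 0\<close> True j v'_lt
        by (metis order.strict_trans1 order.strict_implies_order)
      then show ?thesis using ms j by (simp add: minima_system_def)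
    qed
    moreover have "ip n (rv b) z = 0" using that(2) True by (auto simp: v'_def)
    ultimately have "ip n z s = 0"
      unfolding s_def by (simp add: ip_residual ip_commute[of n z])
    then have "ip n z g = 0" unfolding g_def ip_scale by simp
    then show ?thesis using True by (simp add: e'_def ip_commute[of n g])
  qed
  have "minima_system n T (Suc d) v' e'"
    unfolding minima_system_def
  proof (intro conjI allI impI ballI on')
    fix i assume i: "i < Suc d"
    show "v' i \<in> T"
      using ms b(1) i by (cases "i = d") (auto simp: v'_def minima_system_def)
    show "outside n e' i (v' i)"
      using ms b(2) i by (cases "i = d") (auto simp: v'_def minima_system_def out)
    show "ip n (rv (v' i)) (rv (v' i)) \<le> ip n (rv c) (rv c)"
      if "c \<in> T" "outside n e' i c" for c
      using ms least' i that by (cases "i = d") (auto simp: v'_def minima_system_def out)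
    show "ip n (e' i) z = 0" if "\<forall>j\<le>i. ip n (rv (v' j)) z = 0" for z
      using span[OF i that] .
  qed
  then show ?thesis by blast
qed

text \<open>An orthonormal system has at most \<open>n\<close> members, so a system of greatest
  length exists, and it cannot be extended.\<close>

lemma ex_complete_minima_system:
  obtains d v e where "minima_system n T d v e" "\<And>a. a \<in> T \<Longrightarrow> \<not> outside n e d a"
proof -
  define P where "P d \<longleftrightarrow> (\<exists>v e. minima_system n T d v e)" for d
  have "P 0" by (auto simp: P_def minima_system_def orthonormal_def)
  have bound: "\<forall>d. P d \<longrightarrow> d \<le> n"
    using orthonormal_le_dim by (auto simp: P_def minima_system_def)
  obtain d where "P d" and greatest: "\<forall>k. P k \<longrightarrow> k \<le> d"
    using Nat.ex_has_greatest_nat[OF \<open>P 0\<close> bound] by (elim exE conjE)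
  then obtain v e where ms: "minima_system n T d v e" by (auto simp: P_def)
  have "\<not> P (Suc d)" using greatest by (meson Suc_n_not_le_n)
  then have "\<not> outside n e d a" if "a \<in> T" for a
    using minima_system_extend[OF ms that] unfolding P_def by blast
  then show ?thesis using that ms by blast
qed

text \<open>\<open>v k\<close> was already a candidate when \<open>v i\<close> was chosen, because
  lying outside a larger span entails lying outside a smaller one.\<close>

lemma minima_system_mono:
  assumes "minima_system n T d v e" "i \<le> k" "k < d"
  shows "ip n (rv (v i)) (rv (v i)) \<le> ip n (rv (v k)) (rv (v k))"
proof -
  have "v k \<in> T" "outside n e k (v k)" using assms by (simp_all add: minima_system_def)
  then show ?thesis
    using assms outside_antimono[of n e k "v k" i] by (simp add: minima_system_def)
qed

lemma minima_system_ge_1: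
  assumes "minima_system n T d v e" "i < d"
  shows "1 \<le> ip n (rv (v i)) (rv (v i))"
proof -
  have "outside n e i (v i)" using assms by (simp add: minima_system_def)
  then have "0 < ip n (rv (v i)) (rv (v i))"
    using outside_antimono[of n e i "v i" 0] by (simp add: outside_def)
  then show ?thesis
    unfolding ip_rv by (metis of_int_0_less_iff of_int_1_le_iff int_one_le_iff_zero_less)
qed

text \<open>Orthogonality passes from the \<open>v i\<close> to the \<open>e i\<close>, and from
  these to \<open>T\<close>, which lies in their span. Hence the finitely many \<open>v i\<close>
  can replace \<open>T\<close> as a system of equations.\<close>

lemma minima_system_orthogonal:
  assumes ms: "minima_system n T d v e" and full: "\<And>a. a \<in> T \<Longrightarrow> \<not> outside n e d a"
    and z: "\<And>i. i < d \<Longrightarrow> ip n (rv (v i)) z = 0" and "a \<in> T"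
  shows "ip n (rv a) z = 0"
proof (rule orthogonal_if_not_outside)
  show "orthonormal n d e" using ms by (simp add: minima_system_def)
  show "\<not> outside n e d a" using full \<open>a \<in> T\<close> .
  show "ip n (e i) z = 0" if "i < d" for i
    using ms z that unfolding minima_system_def by (meson order.strict_trans1)
qed

section \<open>Minkowski's second theorem for the orthogonal lattice\<close>

lemma orthonormal_append:
  assumes f: "orthonormal n r f" and e: "orthonormal n d e"
    and fe: "\<And>i j. i < r \<Longrightarrow> j < d \<Longrightarrow> ip n (f i) (e j) = 0"
  shows "orthonormal n (r + d) (\<lambda>i. if i < r then f i else e (i - r))"
  unfolding orthonormal_def
proof (intro allI impI)
  fix i j assume ij: "i < r + d" "j < r + d"
  show "ip n (if i < r then f i else e (i - r)) (if j < r then f j else e (j - r)) =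
      (if i = j then 1 else 0)"
  proof (cases "i < r"; cases "j < r")
    assume "\<not> i < r" "j < r"
    moreover from this have "ip n (e (i - r)) (f j) = 0"
      using ij fe[of j "i - r"] by (simp add: ip_commute)
    ultimately show ?thesis by auto
  qed (use f e fe ij in \<open>auto simp: orthonormal_def\<close>)
qed

text \<open>Minkowski's second theorem for the lattice of integer vectors orthogonal to \<open>S\<close>. Otherwise,
  by the pigeonhole principle, two points of \<open>{0..<H}\<^sup>n\<close> have the same products with a
  spanning part of \<open>S\<close> and nearly the same components along the vectors \<open>e i\<close>; their difference is a
  lattice vector outside the span of \<open>e 0, \<dots>, e (k - 1)\<close> but shorter than \<open>v k\<close>, for some \<open>k\<close>.\<close>

lemma prod_minima_le:
  assumes S: "\<And>x l. x \<in> S \<Longrightarrow> l < n \<Longrightarrow> \<bar>x l\<bar> \<le> int U" and U: "1 \<le> U" and n: "1 \<le> n"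
    and ms: "minima_system n {a. \<forall>x\<in>S. ip n (rv a) (rv x) = 0} d v e"
    and full: "\<And>a. \<forall>x\<in>S. ip n (rv a) (rv x) = 0 \<Longrightarrow> \<not> outside n e d a"
  shows "(\<Prod>i<d. sqrt (ip n (rv (v i)) (rv (v i)))) \<le> (5 * (real n)\<^sup>2 * real U) ^ n"
proof -
  define \<Lambda> where "\<Lambda> = {a. \<forall>x\<in>S. ip n (rv a) (rv x) = 0}"
  define \<mu> where "\<mu> i = sqrt (ip n (rv (v i)) (rv (v i)))" for i
  \<comment> \<open>Applied to \<open>S\<close> itself, the construction selects at most
    \<open>n\<close> elements \<open>x j\<close> spanning \<open>S\<close>, so orthogonality to
    these gives orthogonality to all of \<open>S\<close>.\<close>
  obtain r x f where msx: "minima_system n S r x f"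
    and fullx: "\<And>a. a \<in> S \<Longrightarrow> \<not> outside n f r a"
    using ex_complete_minima_system[of n S] by blast
  have one: "orthonormal n d e" and onf: "orthonormal n r f"
    using ms msx by (auto simp: minima_system_def)
  have v\<Lambda>: "v i \<in> \<Lambda>" if "i < d" for i using ms that by (auto simp: minima_system_def \<Lambda>_def)
  have xS: "x j \<in> S" if "j < r" for j using msx that by (auto simp: minima_system_def)
  have xe: "ip n (rv a) (e i) = 0" if "a \<in> S" "i < d" for a i
  proof -
    have "\<forall>j\<le>i. ip n (rv (v j)) (rv a) = 0" using v\<Lambda> that by (auto simp: \<Lambda>_def)
    then show ?thesis using ms that(2) by (subst ip_commute) (simp add: minima_system_def)
  qed
  have fe: "ip n (f i) (e j) = 0" if "i < r" "j < d" for i j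
    using msx that xS xe unfolding minima_system_def by (meson order.strict_trans1)
  \<comment> \<open>The \<open>f i\<close> span \<open>S\<close> and the \<open>e j\<close> are
    orthogonal to it, so together they are orthonormal in dimension \<open>n\<close>.\<close>
  have rd: "r + d \<le> n"
    using orthonormal_le_dim[OF orthonormal_append[OF onf one fe]] .
  have \<mu>1: "1 \<le> \<mu> i" if "i < d" for i
    unfolding \<mu>_def using minima_system_ge_1[OF ms that] by simp
  have \<mu>0: "0 < \<mu> i" if "i < d" for i using \<mu>1[OF that] by linarith
  have \<mu>mono: "\<mu> i \<le> \<mu> k" if "i \<le> k" "k < d" for i k
    unfolding \<mu>_def using minima_system_mono[OF ms that] by simp
  \<comment> \<open>The side of the box dominates every \<open>\<mu> i\<close>, which keeps the
    ratios in \<open>K i\<close> at least 1. The powers of \<open>H\<close> cancel at the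
    end.\<close>
  define H where "H = nat \<lceil>\<Sum>i<d. \<mu> i\<rceil> + 1"
  have H1: "1 \<le> real H" unfolding H_def by simp
  have \<mu>H: "\<mu> i \<le> real H" if "i < d" for i
  proof -
    have "\<mu> i \<le> (\<Sum>i<d. \<mu> i)"
      using that \<mu>0 by (intro member_le_sum) (auto intro: less_imp_le)
    also have "\<dots> \<le> real H" unfolding H_def by linarith
    finally show ?thesis .
  qed
  define Y where "Y = (\<Pi>\<^sub>E l\<in>{..<n}. {0..<int H})"
  define K where "K i = \<lfloor>(real n)\<^sup>2 * real H / \<mu> i\<rfloor> + 1" for i
  define B where "B = int (n * U * H)"
  \<comment> \<open>The products with the \<open>x j\<close> are recorded exactly, the components
    along \<open>e i\<close> only up to multiples of \<open>\<mu> i / n\<close>.\<close>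
  define g where "g y = (\<lambda>j\<in>{..<r}. \<Sum>l<n. x j l * y l,
      \<lambda>i\<in>{..<d}. \<lfloor>real n * ip n (e i) (rv y) / \<mu> i\<rfloor>)" for y
  define Z where "Z = (\<Pi>\<^sub>E j\<in>{..<r}. {-B..B}) \<times> (\<Pi>\<^sub>E i\<in>{..<d}. {-K i..K i})"
  have Y: "0 \<le> y l" "y l \<le> int H" if "y \<in> Y" "l < n" for y l
    using that by (auto simp: Y_def dest!: PiE_mem)
  have img: "g ` Y \<subseteq> Z"
  proof (rule image_subsetI)
    fix y assume y: "y \<in> Y"
    have 1: "(\<Sum>l<n. x j l * y l) \<in> {-B..B}" if "j < r" for j
    proof -
      have "\<bar>\<Sum>l<n. x j l * y l\<bar> \<le> (\<Sum>l<n. \<bar>x j l * y l\<bar>)" by (rule sum_abs)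
      also have "\<dots> \<le> (\<Sum>l<n. int U * int H)"
        unfolding abs_mult using S[OF xS[OF that]] Y[OF y] by (intro sum_mono mult_mono) auto
      also have "\<dots> = B" by (simp add: B_def)
      finally show ?thesis unfolding atLeastAtMost_iff by linarith
    qed
    have 2: "\<lfloor>real n * ip n (e i) (rv y) / \<mu> i\<rfloor> \<in> {-K i..K i}" if i: "i < d" for i
    proof -
      have "\<bar>ip n (e i) (rv y)\<bar> \<le> (\<Sum>l<n. \<bar>e i l * rv y l\<bar>)"
        unfolding ip_def by (rule sum_abs)
      also have "\<dots> \<le> (\<Sum>l<n. 1 * real H)"
        unfolding abs_mult
      proof (intro sum_mono mult_mono)
        fix l assume l: "l \<in> {..<n}"
        have "(e i l)\<^sup>2 \<le> 1"
          using entry_sq_le_ip[of l n "e i"] one i l by (simp add: orthonormal_def)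
        then show "\<bar>e i l\<bar> \<le> 1" by (simp add: abs_square_le_1)
        show "\<bar>rv y l\<bar> \<le> real H" using Y[OF y, of l] l by simp
      qed auto
      finally have a: "\<bar>ip n (e i) (rv y)\<bar> \<le> real n * real H" by simp
      have "\<bar>real n * ip n (e i) (rv y) / \<mu> i\<bar> = real n * \<bar>ip n (e i) (rv y)\<bar> / \<mu> i"
        using \<mu>1[OF i] by (simp add: abs_mult)
      also have "\<dots> \<le> real n * (real n * real H) / \<mu> i"
        using a \<mu>1[OF i] by (intro divide_right_mono mult_left_mono) auto
      finally have "\<bar>real n * ip n (e i) (rv y) / \<mu> i\<bar> \<le> (real n)\<^sup>2 * real H / \<mu> i"
        by (simp add: power2_eq_square)
      then show ?thesis unfolding K_def atLeastAtMost_iff by linarith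
    qed
    show "g y \<in> Z" unfolding g_def Z_def using 1 2 by auto
  qed
  \<comment> \<open>Two points with the same image would differ by a nonzero lattice vector
    \<open>w\<close> whose component along each \<open>e i\<close> is below
    \<open>\<mu> i / n\<close>.\<close>
  have inj: "inj_on g Y"
  proof (rule inj_onI, rule ccontr)
    fix y y' assume y: "y \<in> Y" "y' \<in> Y" and eq: "g y = g y'" and "y \<noteq> y'"
    then obtain l where l: "l < n" "y l \<noteq> y' l"
      unfolding Y_def by (metis PiE_ext lessThan_iff)
    define w where "w l = y l - y' l" for l
    have ipw: "ip n z (rv w) = ip n z (rv y) - ip n z (rv y')" for z
      using ip_diff[of n z "rv y" "rv y'"] by (simp add: w_def)
    have "ip n (rv (x j)) (rv w) = 0" if "j < r" for j
    proof -
      have "(\<Sum>l<n. x j l * y l) = (\<Sum>l<n. x j l * y' l)"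
        using arg_cong[OF eq, of "\<lambda>p. fst p j"] that by (simp add: g_def)
      then show ?thesis unfolding ipw by (simp only: ip_rv)
    qed
    then have w\<Lambda>: "\<forall>a\<in>S. ip n (rv w) (rv a) = 0"
      using minima_system_orthogonal[OF msx fullx] ip_commute by metis
    have small: "\<bar>ip n (e i) (rv w)\<bar> < \<mu> i / real n" if i: "i < d" for i
    proof -
      have "\<lfloor>real n * ip n (e i) (rv y) / \<mu> i\<rfloor> = \<lfloor>real n * ip n (e i) (rv y') / \<mu> i\<rfloor>"
        using arg_cong[OF eq, of "\<lambda>p. snd p i"] i by (simp add: g_def)
      then have "\<bar>real n * ip n (e i) (rv y) / \<mu> i - real n * ip n (e i) (rv y') / \<mu> i\<bar> < 1"
        by linarith
      then have "\<bar>real n * ip n (e i) (rv w) / \<mu> i\<bar> < 1"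
        by (simp add: ipw right_diff_distrib diff_divide_distrib)
      then show ?thesis using \<mu>1[OF i] n by (simp add: abs_mult field_simps)
    qed
    have "ip n (rv w) (rv w) \<noteq> 0" using l by (auto simp: ip_self_eq_0 w_def)
    then have o0: "outside n e 0 w"
      using ip_self_nonneg[of n "rv w"] by (simp add: outside_def)
    \<comment> \<open>The span of \<open>e 0, ..., e (k - 1)\<close> is the first to contain
      \<open>w\<close>. As \<open>w\<close> is nonzero, \<open>k = Suc m\<close>, and minimality of
      \<open>v m\<close> gives \<open>w\<close> length at least \<open>\<mu> m\<close>.\<close>
    define k where "k = (LEAST k. \<not> outside n e k w)"
    have nk: "\<not> outside n e k w" unfolding k_def by (rule LeastI) (rule full[OF w\<Lambda>])
    have kd: "k \<le> d" unfolding k_def by (rule Least_le) (rule full[OF w\<Lambda>])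
    obtain m where m: "k = Suc m" using nk o0 by (cases k) auto
    have "outside n e m w" using not_less_Least[of m "\<lambda>k. \<not> outside n e k w"] m k_def by auto
    then have ge: "(\<mu> m)\<^sup>2 \<le> ip n (rv w) (rv w)"
      using ms w\<Lambda> m kd ip_self_nonneg by (simp add: minima_system_def \<mu>_def)
    \<comment> \<open>On the other hand, \<open>w\<close> is determined by its first
      \<open>k\<close> components, each below \<open>\<mu> m / n\<close>, which makes it shorter
      than \<open>\<mu> m\<close>.\<close>
    have "(\<Sum>i<k. (ip n (e i) (rv w))\<^sup>2) < (\<Sum>i<k. (\<mu> m / real n)\<^sup>2)"
    proof (rule sum_strict_mono)
      fix i assume i: "i \<in> {..<k}"
      have "\<bar>ip n (e i) (rv w)\<bar> < \<mu> i / real n" using small i kd by auto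
      also have "\<dots> \<le> \<mu> m / real n"
        using \<mu>mono[of i m] i m kd by (intro divide_right_mono) auto
      finally show "(ip n (e i) (rv w))\<^sup>2 < (\<mu> m / real n)\<^sup>2"
        by (metis abs_ge_zero power2_abs power_strict_mono zero_less_numeral)
    qed (use m in auto)
    also have "\<dots> = real k * (\<mu> m / real n)\<^sup>2" by simp
    also have "\<dots> \<le> (real n)\<^sup>2 * (\<mu> m / real n)\<^sup>2"
    proof (rule mult_right_mono)
      have "k \<le> n * n" using kd rd n le_square[of n] by linarith
      then show "real k \<le> (real n)\<^sup>2" unfolding power2_eq_square by (metis of_nat_le_iff of_nat_mult)
    qed simp
    also have "\<dots> = (\<mu> m)\<^sup>2" using n by (simp add: power_divide)
    finally show False using ge nk unfolding outside_def by linarith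
  qed
  \<comment> \<open>One constant serves all factors of \<open>card Z\<close>: at most
    \<open>?c\<close> values for each \<open>x j\<close>, at most \<open>?c / \<mu> i\<close> for
    each \<open>e i\<close>. The 5 comes from \<open>2 * q + 3 \<le> 5 * q\<close> for
    \<open>q \<ge> 1\<close>.\<close>
  let ?c = "5 * (real n)\<^sup>2 * real U * real H"
  have n2: "1 \<le> (real n)\<^sup>2" using n by simp
  have "real (H ^ n) = real (card Y)" by (simp add: Y_def card_PiE)
  also have "\<dots> \<le> real (card Z)"
  proof (rule of_nat_mono[OF card_inj_on_le[OF inj img]])
    show "finite Z" by (simp add: Z_def finite_PiE)
  qed
  also have "\<dots> = (\<Prod>j<r. real (card {-B..B})) * (\<Prod>i<d. real (card {-K i..K i}))"
    unfolding Z_def card_cartesian_product by (simp add: card_PiE)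
  also have "\<dots> \<le> (\<Prod>j<r. ?c) * (\<Prod>i<d. ?c / \<mu> i)"
  proof (intro mult_mono prod_mono conjI)
    have "real (card {-B..B}) = 2 * (real n * real U * real H) + 1" by (simp add: B_def)
    also have "\<dots> \<le> 5 * (real n * real U * real H)"
    proof -
      have "1 * 1 * 1 \<le> real n * real U * real H" using n U H1 by (intro mult_mono) auto
      then show ?thesis by linarith
    qed
    also have "\<dots> \<le> ?c"
    proof -
      have "real n \<le> (real n)\<^sup>2" using n by (simp add: self_le_power)
      then have "real n * (real U * real H) \<le> (real n)\<^sup>2 * (real U * real H)"
        by (intro mult_right_mono) auto
      then show ?thesis by (simp add: mult.assoc)
    qed
    finally show "real (card {-B..B}) \<le> ?c" .
    fix i assume "i \<in> {..<d}"
    then have i: "i < d" by simp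
    let ?q = "(real n)\<^sup>2 * real H / \<mu> i"
    have "1 * \<mu> i \<le> (real n)\<^sup>2 * real H" using n2 \<mu>H[OF i] \<mu>1[OF i] by (intro mult_mono) auto
    then have q1: "1 \<le> ?q" using \<mu>1[OF i] by (simp add: field_simps)
    have "real (card {-K i..K i}) = 2 * real_of_int \<lfloor>?q\<rfloor> + 3"
      using q1 by (simp add: K_def)
    also have "\<dots> \<le> 5 * ?q"
      using q1 of_int_floor_le[of ?q] by linarith
    also have "\<dots> \<le> real U * (5 * ?q)" 
      using U q1 mult_right_mono[of 1 "real U" "5 * ?q"] by simp
    also have "\<dots> = ?c / \<mu> i" by simp
    finally show "real (card {-K i..K i}) \<le> ?c / \<mu> i" .
  qed (use \<mu>0 in \<open>auto intro!: prod_nonneg intro: less_imp_le\<close>)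
  also have "\<dots> = ?c ^ (r + d) / (\<Prod>i<d. \<mu> i)"
    by (simp add: prod_dividef power_add)
  \<comment> \<open>Since \<open>?c \<ge> 1\<close>, the exponent can be raised to \<open>n\<close>,
    so that \<open>H ^ n\<close> cancels against the number of points in the box.\<close>
  also have "\<dots> \<le> ?c ^ n / (\<Prod>i<d. \<mu> i)"
  proof (intro divide_right_mono power_increasing rd prod_nonneg)
    have "1 * 1 * 1 * 1 \<le> ?c" using n2 U H1 by (intro mult_mono) auto
    then show "1 \<le> ?c" by simp
  qed (use \<mu>0 in \<open>auto intro: less_imp_le\<close>)
  finally have "real H ^ n * (\<Prod>i<d. \<mu> i) \<le> ?c ^ n"
    using prod_pos[of "{..<d}" \<mu>] \<mu>0 by (simp add: pos_le_divide_eq)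
  then have "real H ^ n * (\<Prod>i<d. \<mu> i) \<le> real H ^ n * (5 * (real n)\<^sup>2 * real U) ^ n"
    by (simp add: power_mult_distrib mult_ac)
  then show ?thesis using H1 unfolding \<mu>_def by simp
qed

section \<open>From short lattice vectors to a small program\<close>

lemma int_size_le:
  assumes "1 \<le> m" "\<bar>real_of_int z\<bar> \<le> m"
  shows "real (int_size z) \<le> 3 + log 2 m"
proof -
  \<comment> \<open>The sign bit, the \<open>+ 1\<close> in the logarithm and the ceiling cost at
    most one bit each.\<close>
  let ?t = "log 2 (real_of_int \<bar>z\<bar> + 1)"
  have "?t \<le> log 2 (2 * m)" using assms by (subst log_le_cancel_iff) auto
  also have "\<dots> = 1 + log 2 m" using assms by (subst log_mult) auto
  finally have "?t \<le> 1 + log 2 m" .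
  moreover have "0 \<le> ?t" by simp
  ultimately show ?thesis unfolding int_size_def by linarith
qed

lemma mem_solutions_iff:
  assumes "A \<in> carrier_mat M N" "b \<in> carrier_vec M"
  shows "x \<in> solutions (A, b) \<longleftrightarrow> x \<in> carrier_vec N \<and> (\<forall>j<N. 0 \<le> x $ j) \<and>
    (\<forall>i<M. (\<Sum>j<N. A $$ (i, j) * x $ j) = b $ i)"
proof -
  have "(A *\<^sub>v x = b) = (\<forall>i<M. (\<Sum>j<N. A $$ (i, j) * x $ j) = b $ i)" if "x \<in> carrier_vec N"
  proof -
    have "(A *\<^sub>v x) $ i = (\<Sum>j<N. A $$ (i, j) * x $ j)" if "i < M" for i
      using assms \<open>x \<in> carrier_vec N\<close> that by (auto simp: scalar_prod_def atLeast0LessThan)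
    then show ?thesis using assms by (auto simp: vec_eq_iff)
  qed
  then show ?thesis using assms by auto
qed

lemma linf_norm_le_iff: "linf_norm x \<le> int U \<longleftrightarrow> (\<forall>j<dim_vec x. \<bar>x $ j\<bar> \<le> int U)"
  unfolding linf_norm_def by (subst Max_le_iff) auto

text \<open>Homogenisation: the entry -1 at index \<open>N\<close> turns an equation into
  orthogonality to its coefficients followed by its right-hand side.\<close>

definition hom_vec :: "nat \<Rightarrow> int vec \<Rightarrow> nat \<Rightarrow> int" where
  "hom_vec N x l = (if l < N then x $ l else -1)"

lemma ip_hom_vec:
  "ip (Suc N) (rv a) (rv (hom_vec N x)) = 0 \<longleftrightarrow> (\<Sum>j<N. a j * x $ j) = a N"
  unfolding ip_rv of_int_eq_0_iff by (simp add: hom_vec_def)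

lemma ex_small_equivalent:
  assumes "P \<in> ilps M N" and U: "1 \<le> U"
  shows "\<exists>d Q. Q \<in> ilps d N \<and> static_equivalent_upto U P Q \<and>
    real (encoding_size Q) \<le> (real N + 1)\<^sup>2 * (3 + log 2 (5 * (real N + 1)\<^sup>2 * real U))"
proof -
  obtain A b where P: "P = (A, b)" and A: "A \<in> carrier_mat M N" and b: "b \<in> carrier_vec M"
    using assms(1) by (auto simp: ilps_def)
  define n where "n = Suc N"
  \<comment> \<open>Restricting to solutions in the box bounds the entries of \<open>S\<close> by
    \<open>U\<close>; the entry -1 is covered by \<open>U \<ge> 1\<close>.\<close>
  define S where "S = hom_vec N ` {x \<in> solutions P. linf_norm x \<le> int U}"
  define \<Lambda> where "\<Lambda> = {a. \<forall>x\<in>S. ip n (rv a) (rv x) = 0}"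
  obtain d v e where ms: "minima_system n \<Lambda> d v e" and full: "\<And>a. a \<in> \<Lambda> \<Longrightarrow> \<not> outside n e d a"
    using ex_complete_minima_system[of n \<Lambda>] by blast
  define A' where "A' = mat d N (\<lambda>(i, j). v i j)"
  define b' where "b' = vec d (\<lambda>i. v i N)"
  have A': "A' \<in> carrier_mat d N" and b': "b' \<in> carrier_vec d" by (simp_all add: A'_def b'_def)
  have sol': "x \<in> solutions (A', b') \<longleftrightarrow> x \<in> carrier_vec N \<and> (\<forall>j<N. 0 \<le> x $ j) \<and>
      (\<forall>i<d. ip n (rv (v i)) (rv (hom_vec N x)) = 0)" for x
    unfolding mem_solutions_iff[OF A' b'] n_def ip_hom_vec by (simp add: A'_def b'_def)
  define a where "a i l = (if l < N then A $$ (i, l) else b $ i)" for i l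
  have sol: "x \<in> solutions P \<longleftrightarrow> x \<in> carrier_vec N \<and> (\<forall>j<N. 0 \<le> x $ j) \<and>
      (\<forall>i<M. ip n (rv (a i)) (rv (hom_vec N x)) = 0)" for x
    unfolding P mem_solutions_iff[OF A b] n_def ip_hom_vec by (simp add: a_def)
  have a\<Lambda>: "a i \<in> \<Lambda>" if "i < M" for i using sol that by (auto simp: \<Lambda>_def S_def)
  \<comment> \<open>The given rows lie in the lattice, so whatever is orthogonal to all
    \<open>v i\<close> is orthogonal to them: no solution is added, even outside the box.\<close>
  have sub: "solutions (A', b') \<subseteq> solutions P"
  proof
    fix x assume "x \<in> solutions (A', b')"
    then show "x \<in> solutions P"
      unfolding sol sol' using minima_system_orthogonal[OF ms full _ a\<Lambda>] by simp
  qed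
  have "x \<in> solutions (A', b')" if "x \<in> solutions P" "linf_norm x \<le> int U" for x
  proof -
    have "hom_vec N x \<in> S" using that by (auto simp: S_def)
    then have "\<forall>i<d. ip n (rv (v i)) (rv (hom_vec N x)) = 0"
      using ms by (auto simp: minima_system_def \<Lambda>_def)
    then show ?thesis using that(1) unfolding sol sol' by blast
  qed
  then have eq: "static_equivalent_upto U P (A', b')"
    unfolding static_equivalent_upto_def using sub by blast
  define \<mu> where "\<mu> i = sqrt (ip n (rv (v i)) (rv (v i)))" for i
  have \<mu>1: "1 \<le> \<mu> i" if "i < d" for i
    unfolding \<mu>_def using minima_system_ge_1[OF ms that] by simp
  have \<mu>0: "0 < \<mu> i" if "i < d" for i using \<mu>1[OF that] by linarith
  have size: "real (int_size (v i l)) \<le> 3 + log 2 (\<mu> i)" if "i < d" "l < n" for i l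
  proof (rule int_size_le[OF \<mu>1[OF that(1)]])
    show "\<bar>real_of_int (v i l)\<bar> \<le> \<mu> i"
      unfolding \<mu>_def using entry_sq_le_ip[OF that(2), of "rv (v i)"] by (simp add: real_le_rsqrt)
  qed
  have "(\<Prod>i<d. sqrt (ip n (rv (v i)) (rv (v i)))) \<le> (5 * (real n)\<^sup>2 * real U) ^ n"
  proof (rule prod_minima_le)
    fix x l assume "x \<in> S" "l < n"
    then obtain y where y: "y \<in> solutions P" "linf_norm y \<le> int U" "x = hom_vec N y"
      by (auto simp: S_def)
    then show "\<bar>x l\<bar> \<le> int U" using U by (auto simp: hom_vec_def sol linf_norm_le_iff)
  qed (use U ms full in \<open>auto simp: \<Lambda>_def n_def\<close>)
  then have prod: "(\<Prod>i<d. \<mu> i) \<le> (5 * (real n)\<^sup>2 * real U) ^ n" unfolding \<mu>_def .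
  have pos: "0 < (\<Prod>i<d. \<mu> i)"
    using \<mu>0 by (intro prod_pos) auto
  \<comment> \<open>The product bound controls the whole sum of logarithms at once; applying it to
    each \<open>\<mu> i\<close> separately would cost a further factor of up to
    \<open>n\<close>.\<close>
  have "(\<Sum>i<d. log 2 (\<mu> i)) = log 2 (\<Prod>i<d. \<mu> i)"
  proof -
    have "ln (\<Prod>i<d. \<mu> i) = (\<Sum>i<d. ln (\<mu> i))"
      using \<mu>0 by (intro ln_prod) fastforce+
    then show ?thesis by (simp add: log_def sum_divide_distrib)
  qed
  also have "\<dots> \<le> log 2 ((5 * (real n)\<^sup>2 * real U) ^ n)"
    using prod pos by (subst log_le_cancel_iff) auto
  also have "\<dots> = real n * log 2 (5 * (real n)\<^sup>2 * real U)"
    using U by (subst log_nat_power) (auto simp: n_def)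
  finally have logs: "(\<Sum>i<d. log 2 (\<mu> i)) \<le> real n * log 2 (5 * (real n)\<^sup>2 * real U)" .
  have "d \<le> n" using ms orthonormal_le_dim by (auto simp: minima_system_def)
  have "real (encoding_size (A', b')) = (\<Sum>i<d. \<Sum>l<n. real (int_size (v i l)))"
    by (simp add: A'_def b'_def n_def sum.distrib)
  also have "\<dots> \<le> (\<Sum>i<d. \<Sum>l<n. 3 + log 2 (\<mu> i))"
    using size by (intro sum_mono) auto
  also have "\<dots> = real n * (3 * real d + (\<Sum>i<d. log 2 (\<mu> i)))"
    by (simp add: sum.distrib sum_distrib_left[symmetric] algebra_simps)
  also have "\<dots> \<le> real n * (3 * real n + real n * log 2 (5 * (real n)\<^sup>2 * real U))"
    using logs \<open>d \<le> n\<close> by (intro mult_left_mono add_mono) auto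
  also have "\<dots> = (real n)\<^sup>2 * (3 + log 2 (5 * (real n)\<^sup>2 * real U))"
    by (simp add: power2_eq_square algebra_simps)
  finally have "real (encoding_size (A', b')) \<le> (real n)\<^sup>2 * (3 + log 2 (5 * (real n)\<^sup>2 * real U))" .
  moreover have "(A', b') \<in> ilps d N" using A' b' by (simp add: ilps_def)
  ultimately show ?thesis using eq by (auto simp: n_def add.commute)
qed

section \<open>The case \<open>U = 0\<close> and the final size estimate\<close>

lemma ex_small_equivalent_0:
  assumes "P \<in> ilps M N" and N: "1 \<le> N"
  shows "\<exists>d Q. Q \<in> ilps d N \<and> static_equivalent_upto 0 P Q \<and>
    real (encoding_size Q) \<le> 3 * (real N)\<^sup>2"
proof -
  obtain A b where P: "P = (A, b)" and A: "A \<in> carrier_mat M N" and b: "b \<in> carrier_vec M"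
    using assms(1) by (auto simp: ilps_def)
  have s0: "int_size 0 = 1" and s1: "int_size 1 = 2" by (simp_all add: int_size_def)
  have N2: "N \<le> N * N" by (rule le_square)
  have zero: "x = 0\<^sub>v N" if "x \<in> solutions P" "linf_norm x \<le> int 0" for x
    using that unfolding P mem_solutions_iff[OF A b] linf_norm_le_iff by (auto simp: vec_eq_iff)
  \<comment> \<open>If the zero vector is a solution, the system \<open>x = 0\<close> serves;
    otherwise the contradictory row 0 = 1 does.\<close>
  show ?thesis
  proof (cases "0\<^sub>v N \<in> solutions P")
    case True
    have sol: "solutions (1\<^sub>m N, 0\<^sub>v N) = {0\<^sub>v N}" by auto
    have "encoding_size (1\<^sub>m N, 0\<^sub>v N) =
        (\<Sum>i<N. \<Sum>j<N. int_size (if i = j then 1 else 0)) + (\<Sum>i<N. 1)"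
      using s0 by simp
    also have "\<dots> \<le> (\<Sum>i<N. \<Sum>j<N. 2) + (\<Sum>i<N. 1)"
      using s0 s1 by (intro add_mono sum_mono) auto
    also have "\<dots> \<le> 3 * (N * N)" using N2 by simp
    finally have "real (encoding_size (1\<^sub>m N, 0\<^sub>v N)) \<le> real (3 * (N * N))"
      by (rule of_nat_mono)
    moreover have "static_equivalent_upto 0 P (1\<^sub>m N, 0\<^sub>v N)"
      unfolding static_equivalent_upto_def sol using True zero by auto
    ultimately show ?thesis
      by (intro exI[of _ N] exI[of _ "(1\<^sub>m N, 0\<^sub>v N)"]) (simp add: ilps_def power2_eq_square)
  next
    case False
    define b' :: "int vec" where "b' = vec 1 (\<lambda>_. 1)"
    have Z: "0\<^sub>m 1 N \<in> carrier_mat 1 N" and b': "b' \<in> carrier_vec 1" by (simp_all add: b'_def)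
    have sol: "solutions (0\<^sub>m 1 N, b') = {}"
      unfolding set_eq_iff mem_solutions_iff[OF Z b'] by (auto simp: b'_def)
    have "encoding_size (0\<^sub>m 1 N, b') = N + 2"
      using s0 s1 by (simp add: b'_def)
    also have "\<dots> \<le> 3 * (N * N)" using N2 N by linarith
    finally have "real (encoding_size (0\<^sub>m 1 N, b')) \<le> real (3 * (N * N))"
      by (rule of_nat_mono)
    moreover have "static_equivalent_upto 0 P (0\<^sub>m 1 N, b')"
      unfolding static_equivalent_upto_def sol using False zero by auto
    ultimately show ?thesis
      using b' by (intro exI[of _ 1] exI[of _ "(0\<^sub>m 1 N, b')"])
        (simp add: ilps_def power2_eq_square)
  qed
qed

text \<open>From \<open>N + 1 \<le> 2 * N\<close>, the argument of the logarithm is at most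
  \<open>2 ^ 5 * (N * U) ^ 2\<close>. The second factor is then at most 8 plus twice
  \<open>log 2 (N * U)\<close>, hence 10 times the maximum, and the square contributes a factor
  4.\<close>

lemma size_bound:
  assumes N: "1 \<le> N" and U: "1 \<le> U"
  shows "(real N + 1)\<^sup>2 * (3 + log 2 (5 * (real N + 1)\<^sup>2 * real U)) \<le>
    40 * ((real N)\<^sup>2 * max 1 (log 2 (real N * real U)))"
proof -
  let ?x = "real N * real U"
  have x1: "1 * 1 \<le> ?x" using N U by (intro mult_mono) auto
  have N1: "(real N + 1)\<^sup>2 \<le> (2 * real N)\<^sup>2" using N by (intro power_mono) auto
  have "5 * (real N + 1)\<^sup>2 * real U \<le> 8 * (2 * real N)\<^sup>2 * (real U * real U)"
    using N1 U by (intro mult_mono) auto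
  also have "\<dots> = 2 ^ 5 * ?x ^ 2" by (simp add: power2_eq_square)
  finally have "log 2 (5 * (real N + 1)\<^sup>2 * real U) \<le> log 2 (2 ^ 5 * ?x ^ 2)"
    using N U by (subst log_le_cancel_iff) (auto intro!: mult_pos_pos add_pos_pos)
  also have "\<dots> = 5 + 2 * log 2 ?x"
    using x1 N U log_pow_cancel[of "2::real" 5]
    by (subst log_mult) (auto simp: log_nat_power simp del: of_nat_mult)
  also have "3 + \<dots> \<le> 10 * max 1 (log 2 ?x)" by (simp add: max_def)
  finally have L: "3 + log 2 (5 * (real N + 1)\<^sup>2 * real U) \<le> 10 * max 1 (log 2 ?x)" by simp
  have "(real N + 1)\<^sup>2 * (3 + log 2 (5 * (real N + 1)\<^sup>2 * real U))
      \<le> (real N + 1)\<^sup>2 * (10 * max 1 (log 2 ?x))"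
    using L by (intro mult_left_mono) auto
  also have "\<dots> \<le> (2 * real N)\<^sup>2 * (10 * max 1 (log 2 ?x))"
    using N1 by (intro mult_right_mono) auto
  also have "\<dots> = 40 * ((real N)\<^sup>2 * max 1 (log 2 ?x))" by (simp add: power2_eq_square)
  finally show ?thesis .
qed

theorem theorem8:
  "\<exists>C::real. \<forall>(M::nat) (N::nat) (U::nat) P.
     1 \<le> M \<longrightarrow> 1 \<le> N \<longrightarrow> P \<in> ilps M N \<longrightarrow>
     (\<forall>x. smallest_solution P x \<longrightarrow> linf_norm x \<le> int U) \<longrightarrow>
     (\<exists>M' Q. Q \<in> ilps M' N \<and> static_equivalent_upto U P Q \<and>
        real (encoding_size Q) \<le> C * (real M * (real N)\<^sup>2 * max 1 (log 2 (real N * real U))))"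
proof (rule exI[of _ 40], intro allI impI)
  fix M N U :: nat and P :: ilp
  assume M: "1 \<le> M" and N: "1 \<le> N" and P: "P \<in> ilps M N"
  let ?L = "max 1 (log 2 (real N * real U))"
  obtain d Q where Q: "Q \<in> ilps d N" "static_equivalent_upto U P Q"
    and size: "real (encoding_size Q) \<le> 40 * ((real N)\<^sup>2 * ?L)"
  proof (cases "U = 0")
    case True
    show ?thesis
    proof -
      obtain d Q where "Q \<in> ilps d N" "static_equivalent_upto U P Q"
        and "real (encoding_size Q) \<le> 3 * (real N)\<^sup>2"
        using ex_small_equivalent_0[OF P N] True by blast
      \<comment> \<open>Here the logarithm is taken at 0; the maximum with 1 keeps \<open>?L\<close>
        at least 1.\<close>
      moreover have "3 * (real N)\<^sup>2 \<le> 40 * ((real N)\<^sup>2 * ?L)"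
      proof -
        have "(real N)\<^sup>2 * 1 \<le> (real N)\<^sup>2 * ?L" by (intro mult_left_mono) auto
        then show ?thesis using zero_le_power2[of "real N"] by linarith
      qed
      ultimately show ?thesis using that by (meson order.trans)
    qed
  next
    case False
    then have "1 \<le> U" by simp
    then show ?thesis
      using ex_small_equivalent[OF P] size_bound[OF N] that by (meson order.trans)
  qed
  note size
  \<comment> \<open>The estimate so far is free of \<open>M\<close>; the factor
    \<open>M \<ge> 1\<close> can only enlarge it.\<close>
  also have "40 * ((real N)\<^sup>2 * ?L) \<le> 40 * (real M * ((real N)\<^sup>2 * ?L))"
    using M mult_right_mono[of 1 "real M" "(real N)\<^sup>2 * ?L"] by simp
  finally show "\<exists>M' Q. Q \<in> ilps M' N \<and> static_equivalent_upto U P Q \<and>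
      real (encoding_size Q) \<le> 40 * (real M * (real N)\<^sup>2 * ?L)"
    using Q by (intro exI[of _ d] exI[of _ Q]) (simp add: mult.assoc)
qed

end
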